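(* Let $W=\{(l_i,b_i,p_i,\epsilon_i,k_i,\mu_i)\}_{i=1}^{\infty}$ be a BFF and let $\{x_i\}_{i=1}^{\infty}$ be a $W$-good sequence. Let $L_i=\sum_{j=1}^i l_j|x_j|$ (with $L_0=0$), let $q_n=b_i$ for $L_{i-1}<n\le L_i$, let $Q=\{q_n\}_{n=1}^\infty$, let $(E_1,E_2,\ldots)=l_1x_1\,l_2x_2\,l_3x_3\ldots$, and let $x=\sum_{n=1}^{\infty}\frac{E_n}{q_1q_2\cdots q_n}$. If $k\in R(W)$, then $x$ is $Q$-normal of order $k$. If $k_i\to\infty$, then $x$ is $Q$-normal.
   Context: Blocks. A block of length $k$ in base $b$ is an ordered $k$-tuple of integers in $\{0,1,\ldots,b-1\}$; a block is a block of some length in some base. $|B|$ is the length of $B$. For blocks $B_1,B_2,\ldots$ and non-negative integers $l_1,l_2,\ldots$, $l_1B_1\,l_2B_2\ldots$ denotes the concatenation of $l_1$ copies of $B_1$, then $l_2$ copies of $B_2$, and so on. For blocks $B,y$, $N_n(B,y)$ is the number of occurrences of $B$ in $y$ (as consecutive entries) with starting position at most $n$. Cantor series. A basic sequence is a sequence $Q=\{q_n\}_{n\ge1}$ of integers $q_n\ge2$. The $Q$-Cantor series expansion of a real $x\in[0,1)$ is the unique expansion $x=\sum_{n\ge1}\frac{E_n}{q_1\cdots q_n}$ with $E_n\in\{0,\ldots,q_n-1\}$ and $E_n\ne q_n-1$ infinitely often. $N_n^Q(B,x)$ is the number of times the block $B$ occurs starting at a position no greater than $n$ in the $Q$-Cantor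 series expansion of $x$. $Q_n^{(k)}=\sum_{j=1}^n\frac{1}{q_jq_{j+1}\cdots q_{j+k-1}}$. A real number $x$ is $Q$-normal of order $k$ if $\lim_{n\to\infty}N_n^Q(B,x)/Q_n^{(k)}=1$ for all blocks $B$ of length $k$ (in any base), and $Q$-normal if it is $Q$-normal of order $k$ for all $k$. Weightings. A weighting $\mu$ is a collection of functions $\mu^{(k)}:\{0,1,2,\ldots\}^k\to[0,1]$, $k\ge1$, with $\sum_{j=0}^\infty\mu^{(1)}(j)=1$ and $\mu^{(k)}(b_1,\ldots,b_k)=\sum_{j=0}^\infty\mu^{(k+1)}(b_1,\ldots,b_k,j)$ for all $k$. For integers $1\le p\le b$, $\mu$ is $(p,b)$-uniform if $\mu^{(k)}(B)=b^{-k}$ for all $k$ and all blocks $B$ of length $k$ in base $p$. For $0<\epsilon<1$, a positive integer $k$ and a weighting $\mu$, a block $y$ is $(\epsilon,k,\mu)$-normal if for all blocks $B$ of length $m\le k$, $\mu^{(m)}(B)|y|(1-\epsilon)\le N_{|y|}(B,y)\le\mu^{(m)}(B)|y|(1+\epsilon)$. BFF. A BFF (block friendly family) is a sequence of $6$-tuples $W=\{(l_i,b_i,p_i,\epsilon_i,k_i,\mu_i)\}_{i\ge1}$ where $\{l_i\},\{b_i\},\{p_i\},\{k_i\}$ are non-decreasing sequences of non-negative integers with $b_i\ge2$, $b_i\to\infty$ and $p_i\to\infty$; $\{\mu_i\}$ is a sequence of $(p_i,b_i)$-uniform weightings; and $\{\epsilon_i\}$ strictly decreases to $0$. $R(W)=\{0,1,\ldots,K\}$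 if $\lim k_i=K<\infty$, and $R(W)=\{0,1,2,\ldots\}$ otherwise. $W$-good. A sequence of blocks $\{x_i\}_{i\ge1}$ with $|x_i|$ non-decreasing and each $x_i$ being $(\epsilon_i,k_i,\mu_i)$-normal is $W$-good if for every $k\in R(W)$, as $i\to\infty$: (1) $|x_i|\Big/\frac{b_i^k}{\epsilon_{i-1}-\epsilon_i}\to\infty$; (2) $\frac{l_{i-1}}{l_i}\cdot\frac{|x_{i-1}|}{|x_i|}=o(i^{-1}b_i^{-k})$; (3) $\frac1{l_i}\cdot\frac{|x_{i+1}|}{|x_i|}=o(b_i^{-k})$.
   Formalization: Adds the hypothesis that E_n < q_n for all n ≥ 1, i.e. that (E_n) is a digit sequence for Q; if p_i < b_i the blocks x_i may contain entries ≥ b_i, and carries can then destroy normality. Also makes explicit that l_i is nonzero for large i. *)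

theory Defs
  imports "HOL-Analysis.Analysis" "HOL-Library.Landau_Symbols" "HOL-Library.Sublist"
begin

text \<open>
  Blocks are lists of naturals; every such list is a block in some base.  All sequences are
  indexed from 1 as on paper, their value at index 0 is never used.
\<close>

type_synonym block = "nat list"

definition block_in_base :: "nat \<Rightarrow> block \<Rightarrow> bool" where
  "block_in_base b B \<longleftrightarrow> set B \<subseteq> {..<b}"

definition block_count :: "nat \<Rightarrow> block \<Rightarrow> block \<Rightarrow> nat" where
  "block_count n B y = card {s \<in> {1..n}. prefix B (drop (s - 1) y)}"

definition seq_count :: "nat \<Rightarrow> block \<Rightarrow> (nat \<Rightarrow> nat) \<Rightarrow> nat" where
  "seq_count n B E = card {s \<in> {1..n}. \<forall>i<length B. E (s + i) = B ! i}"


definition basic_sequence :: "(nat \<Rightarrow> nat) \<Rightarrow> bool" where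
  "basic_sequence q \<longleftrightarrow> (\<forall>n\<ge>1. 2 \<le> q n)"

definition cantor_term :: "(nat \<Rightarrow> nat) \<Rightarrow> (nat \<Rightarrow> nat) \<Rightarrow> nat \<Rightarrow> real" where
  "cantor_term q E n = real (E n) / (\<Prod>j=1..n. real (q j))"

definition cantor_expansion :: "(nat \<Rightarrow> nat) \<Rightarrow> real \<Rightarrow> (nat \<Rightarrow> nat) \<Rightarrow> bool" where
  "cantor_expansion q x E \<longleftrightarrow>
     (\<forall>n\<ge>1. E n \<le> q n - 1) \<and>
     (\<exists>\<^sub>\<infinity>n. E n \<noteq> q n - 1) \<and>
     (\<lambda>n. cantor_term q E (Suc n)) sums x"

text \<open>
  Expansions exist only on $[0,1)$; a real outside this interval is given the digits of its
  fractional part.  The condition at index 0 only fixes the unused value.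
\<close>

definition cantor_digits :: "(nat \<Rightarrow> nat) \<Rightarrow> real \<Rightarrow> nat \<Rightarrow> nat" where
  "cantor_digits q x = (THE E. E 0 = 0 \<and> cantor_expansion q (frac x) E)"

definition cantor_count :: "(nat \<Rightarrow> nat) \<Rightarrow> nat \<Rightarrow> block \<Rightarrow> real \<Rightarrow> nat" where
  "cantor_count q n B x = seq_count n B (cantor_digits q x)"

definition Q_sum :: "(nat \<Rightarrow> nat) \<Rightarrow> nat \<Rightarrow> nat \<Rightarrow> real" where
  "Q_sum q k n = (\<Sum>j=1..n. 1 / (\<Prod>i<k. real (q (j + i))))"

definition Q_normal_of_order :: "(nat \<Rightarrow> nat) \<Rightarrow> nat \<Rightarrow> real \<Rightarrow> bool" where
  "Q_normal_of_order q k x \<longleftrightarrow> basic_sequence q \<and>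
     (\<forall>B::block. length B = k \<longrightarrow>
        (\<lambda>n. real (cantor_count q n B x) / Q_sum q k n) \<longlonglongrightarrow> 1)"

definition Q_normal :: "(nat \<Rightarrow> nat) \<Rightarrow> real \<Rightarrow> bool" where
  "Q_normal q x \<longleftrightarrow> (\<forall>k. Q_normal_of_order q k x)"


text \<open>
  The functions $\mu^{(k)}$, $k \ge 1$, are bundled into one function on lists, $\mu^{(k)}$ being
  its restriction to lists of length $k$; the value at the empty list is never used.
\<close>

type_synonym weighting = "block \<Rightarrow> real"

definition is_weighting :: "weighting \<Rightarrow> bool" where
  "is_weighting \<mu> \<longleftrightarrow>
     (\<forall>B. B \<noteq> [] \<longrightarrow> \<mu> B \<in> {0..1}) \<and>
     (\<lambda>j. \<mu> [j]) sums 1 \<and>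
     (\<forall>B. B \<noteq> [] \<longrightarrow> (\<lambda>j. \<mu> (B @ [j])) sums \<mu> B)"

definition uniform_weighting :: "nat \<Rightarrow> nat \<Rightarrow> weighting \<Rightarrow> bool" where
  "uniform_weighting p b \<mu> \<longleftrightarrow> is_weighting \<mu> \<and> 1 \<le> p \<and> p \<le> b \<and>
     (\<forall>B. B \<noteq> [] \<and> block_in_base p B \<longrightarrow> \<mu> B = 1 / real b ^ length B)"

text \<open>For $k = 0$ (which block friendly families allow) the condition on blocks is void.\<close>

definition normal_block :: "real \<Rightarrow> nat \<Rightarrow> weighting \<Rightarrow> block \<Rightarrow> bool" where
  "normal_block \<epsilon> k \<mu> y \<longleftrightarrow> 0 < \<epsilon> \<and> \<epsilon> < 1 \<and> is_weighting \<mu> \<and>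
     (\<forall>B. 1 \<le> length B \<and> length B \<le> k \<longrightarrow>
        \<mu> B * real (length y) * (1 - \<epsilon>) \<le> real (block_count (length y) B y) \<and>
        real (block_count (length y) B y) \<le> \<mu> B * real (length y) * (1 + \<epsilon>))"


record bff_entry =
  reps :: nat          \<comment> \<open>$l_i$\<close>
  base :: nat          \<comment> \<open>$b_i$\<close>
  subbase :: nat       \<comment> \<open>$p_i$\<close>
  eps :: real          \<comment> \<open>$\epsilon_i$\<close>
  ord_bound :: nat     \<comment> \<open>$k_i$\<close>
  weight :: weighting  \<comment> \<open>$\mu_i$\<close>

definition BFF :: "(nat \<Rightarrow> bff_entry) \<Rightarrow> bool" where
  "BFF W \<longleftrightarrow>
     mono_on {1..} (\<lambda>i. reps (W i)) \<and>
     mono_on {1..} (\<lambda>i. base (W i)) \<and>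
     mono_on {1..} (\<lambda>i. subbase (W i)) \<and>
     mono_on {1..} (\<lambda>i. ord_bound (W i)) \<and>
     (\<forall>i\<ge>1. 2 \<le> base (W i)) \<and>
     filterlim (\<lambda>i. base (W i)) at_top sequentially \<and>
     filterlim (\<lambda>i. subbase (W i)) at_top sequentially \<and>
     (\<forall>i\<ge>1. uniform_weighting (subbase (W i)) (base (W i)) (weight (W i))) \<and>
     (\<forall>i\<ge>1. eps (W (Suc i)) < eps (W i)) \<and>
     (\<lambda>i. eps (W i)) \<longlonglongrightarrow> 0"

definition R :: "(nat \<Rightarrow> bff_entry) \<Rightarrow> nat set" where
  "R W = (if convergent (\<lambda>i. ord_bound (W i)) then {0..lim (\<lambda>i. ord_bound (W i))} else UNIV)"

text \<open>
  The conditions involving $1/l_i$ presuppose $l_i \neq 0$ for large $i$; this is demanded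
  explicitly because division by zero yields zero.
\<close>

definition W_good :: "(nat \<Rightarrow> bff_entry) \<Rightarrow> (nat \<Rightarrow> block) \<Rightarrow> bool" where
  "W_good W X \<longleftrightarrow>
     mono_on {1..} (\<lambda>i. length (X i)) \<and>
     (\<forall>i\<ge>1. normal_block (eps (W i)) (ord_bound (W i)) (weight (W i)) (X i)) \<and>
     (\<forall>\<^sub>F i in sequentially. reps (W i) \<noteq> 0) \<and>
     (\<forall>k\<in>R W.
        filterlim (\<lambda>i. real (length (X i)) / (real (base (W i)) ^ k / (eps (W (i - 1)) - eps (W i))))
          at_top sequentially \<and>
        (\<lambda>i. real (reps (W (i - 1))) / real (reps (W i)) *
             (real (length (X (i - 1))) / real (length (X i))))
          \<in> o(\<lambda>i. 1 / (real i * real (base (W i)) ^ k)) \<and>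
        (\<lambda>i. 1 / real (reps (W i)) * (real (length (X (i + 1))) / real (length (X i))))
          \<in> o(\<lambda>i. 1 / real (base (W i)) ^ k))"

definition total_length :: "(nat \<Rightarrow> bff_entry) \<Rightarrow> (nat \<Rightarrow> block) \<Rightarrow> nat \<Rightarrow> nat" where
  "total_length W X i = (\<Sum>j=1..i. reps (W j) * length (X j))"

text \<open>The finite block $l_1x_1\,l_2x_2 \ldots l_ix_i$.\<close>

definition concat_upto :: "(nat \<Rightarrow> bff_entry) \<Rightarrow> (nat \<Rightarrow> block) \<Rightarrow> nat \<Rightarrow> block" where
  "concat_upto W X i = concat (map (\<lambda>j. concat (replicate (reps (W j)) (X j))) [1..<Suc i])"

text \<open>$(E_1, E_2, \ldots) = l_1x_1\,l_2x_2\,l_3x_3 \ldots$\<close>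

definition is_concatenation ::
    "(nat \<Rightarrow> bff_entry) \<Rightarrow> (nat \<Rightarrow> block) \<Rightarrow> (nat \<Rightarrow> nat) \<Rightarrow> bool" where
  "is_concatenation W X E \<longleftrightarrow>
     (\<forall>i. map E [1..<Suc (total_length W X i)] = concat_upto W X i)"

end

theory Submission
  imports Defs
begin

text \<open>
  A copy of $x_i$ contains $|x_i| b_i^{-k}$ occurrences of $B$ up to a relative error that tends to
  zero: the error is $\epsilon_i$ plus at most $k$ occurrences straddling the end of the copy, and
  $|x_i| / b_i^k \to \infty$ by (1).  The weights $1/(q_s \cdots q_{s+k-1})$ over the same copy
  also add up to $|x_i| b_i^{-k}$, up to the last $k$ of them.  So counts and weights agree
  asymptotically along complete copies, and an incomplete copy of $x_{i+1}$ at the end is negligible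
  against the section $l_i x_i$ by (3).  That the $E_n$ are the digits of $x$ follows because
  the numerator of the $n$-th partial sum over $q_1 \cdots q_n$ is
  $\lfloor x q_1 \cdots q_n \rfloor$.
\<close>

section \<open>Uniqueness of Cantor series expansions\<close>

text \<open>Horner's scheme for the numerator over the common denominator
  \<open>cantor_den q n\<close>. It stays in \<open>nat\<close>, so that digits can be recovered
  from it exactly.\<close>

primrec cantor_num :: "(nat \<Rightarrow> nat) \<Rightarrow> (nat \<Rightarrow> nat) \<Rightarrow> nat \<Rightarrow> nat" where
  "cantor_num q E 0 = 0"
| "cantor_num q E (Suc n) = q (Suc n) * cantor_num q E n + E (Suc n)"

definition cantor_den :: "(nat \<Rightarrow> nat) \<Rightarrow> nat \<Rightarrow> real" where
  "cantor_den q n = (\<Prod>j=1..n. real (q j))"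

lemma cantor_den_0 [simp]: "cantor_den q 0 = 1"
  by (simp add: cantor_den_def)

lemma cantor_den_Suc: "cantor_den q (Suc n) = cantor_den q n * real (q (Suc n))"
  by (simp add: cantor_den_def)

context
  fixes q E :: "nat \<Rightarrow> nat"
  assumes basic: "basic_sequence q"
    and digit_less: "\<And>n. 1 \<le> n \<Longrightarrow> E n < q n"
begin

private abbreviation P :: "nat \<Rightarrow> real" where "P n \<equiv> cantor_den q n"

private lemma q_pos: "1 \<le> n \<Longrightarrow> 0 < q n"
  using digit_less[of n] by simp

private lemma P_pos: "0 < P n"
  unfolding cantor_den_def by (intro prod_pos) (auto simp: q_pos)

private lemma P_ge: "2 ^ n \<le> P n"
proof (induction n)
  case (Suc n)
  have "2 \<le> real (q (Suc n))" using basic by (simp add: basic_sequence_def)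
  then have "2 ^ n * 2 \<le> P n * real (q (Suc n))"
    using Suc P_pos[of n] by (intro mult_mono) (auto simp: less_imp_le)
  then show ?case by (simp add: cantor_den_Suc mult.commute)
qed simp

private lemma inverse_P_tendsto: "(\<lambda>n. 1 / P n) \<longlonglongrightarrow> 0"
proof (rule tendsto_sandwich[where f = "\<lambda>_. 0"])
  show "(\<lambda>n. (1/2::real) ^ n) \<longlonglongrightarrow> 0" by (intro LIMSEQ_power_zero) simp
  show "\<forall>\<^sub>F n in sequentially. 1 / P n \<le> (1/2::real) ^ n"
    using P_ge P_pos by (auto simp: power_one_over divide_simps intro!: always_eventually)
  show "\<forall>\<^sub>F n in sequentially. 0 \<le> 1 / P n"
    using P_pos by (auto intro!: always_eventually simp: less_imp_le)
qed simp

lemma cantor_partial_sum: "(\<Sum>m<n. cantor_term q E (Suc m)) = cantor_num q E n / P n"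
proof (induction n)
  case (Suc n)
  have "real (q (Suc n)) \<noteq> 0" using q_pos[of "Suc n"] by simp
  then show ?case
    using Suc P_pos[of n] P_pos[of "Suc n"]
    unfolding sum.lessThan_Suc Suc.IH cantor_term_def cantor_den_def[symmetric] cantor_den_Suc
    by (simp add: field_simps)
qed simp

private lemma lower_mono: "incseq (\<lambda>n. cantor_num q E n / P n)"
proof (rule incseq_SucI)
  fix n
  have "0 < real (q (Suc n))" using q_pos[of "Suc n"] by simp
  then show "cantor_num q E n / P n \<le> cantor_num q E (Suc n) / P (Suc n)"
    unfolding cantor_den_Suc using P_pos[of n] by (simp add: field_simps)
qed

text \<open>The intervals from \<open>cantor_num q E n / P n\<close> to
  \<open>(cantor_num q E n + 1) / P n\<close> are nested. The right end drops in proportion to the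
  gap between the new digit and the maximal one, hence strictly unless that digit is
  maximal.\<close>

private lemma upper_step:
  "(cantor_num q E (Suc n) + 1) / P (Suc n)
     = (cantor_num q E n + 1) / P n - (real (q (Suc n)) - 1 - real (E (Suc n))) / P (Suc n)"
proof -
  have "0 < real (q (Suc n))" using q_pos[of "Suc n"] by simp
  then show ?thesis
    unfolding cantor_den_Suc using P_pos[of n] by (simp add: field_simps)
qed

private lemma upper_antimono: "decseq (\<lambda>n. (cantor_num q E n + 1) / P n)"
proof (rule decseq_SucI)
  fix n
  have "0 \<le> (real (q (Suc n)) - 1 - real (E (Suc n))) / P (Suc n)"
    using digit_less[of "Suc n"] P_pos[of "Suc n"]
    by (intro divide_nonneg_pos) auto
  then show "(cantor_num q E (Suc n) + 1) / P (Suc n) \<le> (cantor_num q E n + 1) / P n"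
    unfolding upper_step by simp
qed

text \<open>The partial sums increase and are bounded by the right end of the interval for
  \<open>n = 0\<close>, which is 1.\<close>

lemma cantor_summable: "summable (\<lambda>n. cantor_term q E (Suc n))"
proof -
  have "cantor_num q E n / P n \<le> 1" for n
  proof -
    have "cantor_num q E n / P n \<le> (cantor_num q E n + 1) / P n"
      using P_pos[of n] by (simp add: divide_right_mono)
    also have "\<dots> \<le> 1" using upper_antimono[THEN decseqD, of 0 n] by simp
    finally show ?thesis .
  qed
  then obtain l where "(\<lambda>n. cantor_num q E n / P n) \<longlonglongrightarrow> l"
    using incseq_convergent[OF lower_mono] by blast
  then have "convergent (\<lambda>n. cantor_num q E n / P n)"
    by (rule convergentI)
  then show ?thesis by (simp add: summable_iff_convergent cantor_partial_sum)
qed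

text \<open>The limit \<open>x\<close> lies in all the nested intervals, and infinitely many
  non-maximal digits keep it strictly below every right end. Scaling by \<open>P n\<close> gives the
  floor; the interval for \<open>n = 0\<close> gives the bounds on \<open>x\<close>.\<close>

lemma cantor_num_eq_floor:
  assumes sums: "(\<lambda>n. cantor_term q E (Suc n)) sums x"
    and inf: "\<exists>\<^sub>\<infinity>n. E n \<noteq> q n - 1"
  shows "int (cantor_num q E n) = \<lfloor>x * P n\<rfloor>" "0 \<le> x" "x < 1"
proof -
  have lim: "(\<lambda>n. cantor_num q E n / P n) \<longlonglongrightarrow> x"
    using sums by (simp add: sums_def cantor_partial_sum)
  then have "(\<lambda>n. cantor_num q E n / P n + 1 / P n) \<longlonglongrightarrow> x + 0"
    by (intro tendsto_add inverse_P_tendsto)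
  then have lim': "(\<lambda>n. (cantor_num q E n + 1) / P n) \<longlonglongrightarrow> x"
    by (simp add: add_divide_distrib add.commute)
  have lower: "cantor_num q E n / P n \<le> x" for n
    using incseq_le[OF lower_mono lim] .
  have upper: "x < (cantor_num q E n + 1) / P n" for n
  proof -
    \<comment> \<open>Taking \<open>m\<close> beyond \<open>n\<close> leaves a predecessor
      \<open>m'\<close> with \<open>n \<le> m'\<close>, so the strict drop of the right end at
      \<open>m\<close> happens after \<open>n\<close>.\<close>
    obtain m where m: "Suc n \<le> m" "E m \<noteq> q m - 1"
      using inf by (auto simp: INFM_nat_le)
    then obtain m' where m': "m = Suc m'" "n \<le> m'" by (cases m) auto
    have "0 < (real (q m) - 1 - real (E m)) / P m"
      using digit_less[of m] m P_pos[of m] by (intro divide_pos_pos) auto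
    then have "(cantor_num q E m + 1) / P m < (cantor_num q E m' + 1) / P m'"
      unfolding m' upper_step by simp
    also have "\<dots> \<le> (cantor_num q E n + 1) / P n"
      using upper_antimono[THEN decseqD, OF m'(2)] .
    finally show ?thesis using decseq_ge[OF upper_antimono lim', of m] by linarith
  qed
  show "int (cantor_num q E n) = \<lfloor>x * P n\<rfloor>"
    using lower[of n] upper[of n] P_pos[of n]
    by (intro floor_unique[symmetric]) (auto simp: field_simps)
  show "0 \<le> x" "x < 1" using lower[of 0] upper[of 0] by simp_all
qed

end

text \<open>The floors depend on \<open>x\<close> alone, so both expansions have the same
  numerators; the recursion for \<open>cantor_num\<close> then forces equal digits.\<close>

lemma cantor_expansion_unique:
  assumes basic: "basic_sequence q" and "cantor_expansion q x E" "cantor_expansion q x F" "1 \<le> n"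
  shows "E n = F n"
proof -
  have less: "G n < q n" if "cantor_expansion q x G" "1 \<le> n" for G n
  proof -
    have "G n \<le> q n - 1" "2 \<le> q n"
      using that basic by (auto simp: cantor_expansion_def basic_sequence_def)
    then show ?thesis by linarith
  qed
  have "int (cantor_num q E m) = int (cantor_num q F m)" for m
    using cantor_num_eq_floor(1)[OF basic less[OF assms(2)], of x m]
      cantor_num_eq_floor(1)[OF basic less[OF assms(3)], of x m] assms(2,3)
    by (auto simp: cantor_expansion_def)
  then have "cantor_num q E m = cantor_num q F m" for m by simp
  moreover obtain m where "n = Suc m" using \<open>1 \<le> n\<close> by (cases n) auto
  ultimately show ?thesis
    by (metis add_left_cancel cantor_num.simps(2))
qed

text \<open>The value \<open>E 0\<close> is arbitrary, whereas \<open>cantor_digits\<close>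
  prescribes 0 there; hence the update.\<close>

lemma cantor_digits_eq:
  assumes basic: "basic_sequence q" and less: "\<And>n. 1 \<le> n \<Longrightarrow> E n < q n"
    and inf: "\<exists>\<^sub>\<infinity>n. E n \<noteq> q n - 1"
  shows "cantor_digits q (\<Sum>n. cantor_term q E (Suc n)) = E(0 := 0)"
proof -
  define x where "x = (\<Sum>n. cantor_term q E (Suc n))"
  have sums: "(\<lambda>n. cantor_term q E (Suc n)) sums x"
    unfolding x_def using cantor_summable[OF basic less] by (rule summable_sums)
  have "frac x = x"
    using cantor_num_eq_floor(2,3)[OF basic less sums inf] by (simp add: frac_eq)
  moreover have "\<exists>\<^sub>\<infinity>n. (E(0 := 0)) n \<noteq> q n - 1"
    unfolding INFM_nat_le
  proof
    fix m
    obtain n where "Suc m \<le> n" "E n \<noteq> q n - 1" using inf by (auto simp: INFM_nat_le)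
    then show "\<exists>n\<ge>m. (E(0 := 0)) n \<noteq> q n - 1" by (intro exI[of _ n]) auto
  qed
  moreover have "E n \<le> q n - 1" if "1 \<le> n" for n using less[OF that] by simp
  ultimately have E: "cantor_expansion q (frac x) (E(0 := 0))"
    using sums by (auto simp: cantor_expansion_def cantor_term_def)
  show ?thesis
    unfolding cantor_digits_def x_def[symmetric]
  proof (rule the_equality)
    show "(E(0 := 0)) 0 = 0 \<and> cantor_expansion q (frac x) (E(0 := 0))" using E by simp
  next
    fix F assume F: "F 0 = 0 \<and> cantor_expansion q (frac x) F"
    show "F = E(0 := 0)"
    proof
      fix n show "F n = (E(0 := 0)) n"
        using F cantor_expansion_unique[OF basic _ E, of F n] by (cases "n = 0") auto
    qed
  qed
qed

section \<open>Counting and concatenation\<close>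

text \<open>Counts become sums of indicators with start positions shifted to begin at 0, so that
  they split along copies and compare termwise with \<open>Q_sum\<close>.\<close>

lemma seq_count_eq_sum:
  "real (seq_count n B E) = (\<Sum>s<n. of_bool (\<forall>i<length B. E (Suc s + i) = B ! i))"
proof -
  have "real (seq_count n B E) = (\<Sum>s=1..n. of_bool (\<forall>i<length B. E (s + i) = B ! i))"
    by (simp add: seq_count_def of_bool_def sum.If_cases Int_def)
  then show ?thesis by (simp add: sum.atLeast1_atMost_eq)
qed

lemma Q_sum_eq_sum: "Q_sum q k n = (\<Sum>s<n. 1 / (\<Prod>i<k. real (q (Suc s + i))))"
  by (simp add: Q_sum_def sum.atLeast1_atMost_eq)

lemma block_count_eq_sum:
  "real (block_count n B y) = (\<Sum>s<n. of_bool (prefix B (drop s y)))"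
proof -
  have "real (block_count n B y) = (\<Sum>s=1..n. of_bool (prefix B (drop (s - 1) y)))"
    by (simp add: block_count_def of_bool_def sum.If_cases Int_def)
  then show ?thesis by (simp add: sum.atLeast1_atMost_eq)
qed

lemma prefix_drop_iff:
  assumes "t + length B \<le> length y"
  shows "prefix B (drop t y) \<longleftrightarrow> (\<forall>i<length B. y ! (t + i) = B ! i)"
  unfolding prefix_def using assms
  by (auto simp: list_eq_iff_nth_eq nth_append
      intro!: exI[of _ "drop (t + length B) y"])

lemma sum_lessThan_add:
  fixes f :: "nat \<Rightarrow> 'a::comm_monoid_add"
  shows "(\<Sum>s<n + m. f s) = (\<Sum>s<n. f s) + (\<Sum>s<m. f (n + s))"
  by (induction m) (simp_all add: add.assoc)

text \<open>Meant for \<open>P\<close> = occurrence inside a finite block of length \<open>m\<close>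
  and \<open>P'\<close> = occurrence in the infinite sequence: they can differ only where a window
  of length \<open>k\<close> sticks out of the block, and there \<open>P\<close> fails.\<close>

lemma sum_of_bool_eq_up_to_last:
  assumes "\<And>t. t + k \<le> m \<Longrightarrow> P t \<longleftrightarrow> P' t" and "\<And>t. t < m \<Longrightarrow> m < t + k \<Longrightarrow> \<not> P t"
  shows "(\<Sum>t<m. of_bool (P t)) \<le> (\<Sum>t<m. of_bool (P' t) :: real)"
    and "(\<Sum>t<m. of_bool (P' t)) \<le> (\<Sum>t<m. of_bool (P t)) + real k"
proof -
  show "(\<Sum>t<m. of_bool (P t)) \<le> (\<Sum>t<m. of_bool (P' t) :: real)"
  proof (rule sum_mono)
    fix t assume "t \<in> {..<m}"
    then show "of_bool (P t) \<le> (of_bool (P' t) :: real)"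
      using assms(1)[of t] assms(2)[of t] by (cases "t + k \<le> m") auto
  qed
  \<comment> \<open>Every \<open>t < m\<close> with \<open>m < t + k\<close> lies in
    \<open>{m-k..<m}\<close>, which has at most \<open>k\<close> elements, also if the subtraction
    is truncated.\<close>
  have "(\<Sum>t<m. of_bool (P' t)) \<le> (\<Sum>t<m. of_bool (P t) + of_bool (t \<in> {m-k..<m}) :: real)"
  proof (rule sum_mono)
    fix t assume "t \<in> {..<m}"
    then show "of_bool (P' t) \<le> (of_bool (P t) + of_bool (t \<in> {m-k..<m}) :: real)"
      using assms(1)[of t] by (cases "t + k \<le> m") auto
  qed
  also have "\<dots> = (\<Sum>t<m. of_bool (P t)) + real (card {t. t < m \<and> m - k \<le> t \<and> t < m})"
    by (simp only: sum.distrib)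
      (auto simp: of_bool_def sum.If_cases intro!: arg_cong[where f = card])
  also have "{t. t < m \<and> m - k \<le> t \<and> t < m} = {m-k..<m}" by auto
  finally show "(\<Sum>t<m. of_bool (P' t)) \<le> (\<Sum>t<m. of_bool (P t)) + real k"
    by (simp add: of_nat_diff)
qed

lemma nth_concat_replicate:
  assumes "c < l" "t < length xs"
  shows "concat (replicate l xs) ! (c * length xs + t) = xs ! t"
  using assms
proof (induction l arbitrary: c)
  case (Suc l)
  then show ?case by (cases c) (auto simp: nth_append)
qed simp

lemma length_concat_replicate: "length (concat (replicate l xs)) = l * length xs"
  by (induction l) auto

text \<open>The constant \<open>C\<close> may depend on \<delta> and will hold the error of an
  initial segment. Since \<open>S\<close> diverges, \<open>C\<close> is eventually at most
  \<open>\<delta> * S n\<close>, leaving a relative error of at most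
  \<open>2 * \<delta>\<close>.\<close>

lemma tendsto_1_if_diff_small:
  fixes A S :: "nat \<Rightarrow> real"
  assumes S: "filterlim S at_top sequentially"
    and close: "\<And>\<delta>. 0 < \<delta> \<Longrightarrow> \<delta> < 1 \<Longrightarrow> \<exists>C. \<forall>\<^sub>F n in sequentially. \<bar>A n - S n\<bar> \<le> C + \<delta> * S n"
  shows "(\<lambda>n. A n / S n) \<longlonglongrightarrow> 1"
proof (rule tendstoI)
  fix e :: real assume "0 < e"
  define \<delta> where "\<delta> = min (e / 3) (1 / 2)"
  have \<delta>: "0 < \<delta>" "\<delta> < 1" "2 * \<delta> < e" using \<open>0 < e\<close> by (auto simp: \<delta>_def)
  obtain C where C: "\<forall>\<^sub>F n in sequentially. \<bar>A n - S n\<bar> \<le> C + \<delta> * S n"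
    using close[OF \<delta>(1,2)] by blast
  have "\<forall>\<^sub>F n in sequentially. max 1 (C / \<delta>) \<le> S n"
    using S unfolding filterlim_at_top by blast
  with C show "\<forall>\<^sub>F n in sequentially. dist (A n / S n) 1 < e"
  proof eventually_elim
    case (elim n)
    have S: "1 \<le> S n" "C \<le> \<delta> * S n"
      using elim \<delta> by (auto simp: field_simps)
    have "\<bar>A n - S n\<bar> \<le> 2 * \<delta> * S n" using elim S by linarith
    also have "\<dots> < e * S n" using \<delta> S by (intro mult_strict_right_mono) auto
    finally have "\<bar>A n - S n\<bar> / S n < e" using S by (simp add: field_simps)
    moreover have "A n / S n - 1 = (A n - S n) / S n" using S by (simp add: field_simps)
    ultimately show ?case using S by (simp add: dist_real_def)
  qed
qed

section \<open>Concatenations of good sequences\<close>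

text \<open>If no index from 1 on has a value of at least \<open>k\<close>, then \<open>f\<close> is
  bounded, hence eventually equal to its maximum; this is its limit, contradicting
  \<open>k \<le> lim f\<close>. The premise covers both cases in the definition of
  \<open>R\<close>.\<close>

lemma mono_nat_eventually_ge:
  fixes f :: "nat \<Rightarrow> nat"
  assumes mono: "mono_on {1..} f" and "convergent f \<Longrightarrow> k \<le> lim f"
  shows "\<forall>\<^sub>F i in sequentially. k \<le> f i"
proof (cases "\<exists>i\<ge>1. k \<le> f i")
  case True
  then obtain i where i: "1 \<le> i" "k \<le> f i" by blast
  show ?thesis using eventually_ge_at_top[of i]
  proof eventually_elim
    case (elim j)
    then have "f i \<le> f j" using i by (intro mono_onD[OF mono]) auto
    then show ?case using i by simp
  qed
next
  case False
  have fin: "finite (f ` {1..})"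
    by (rule finite_subset[of _ "{..k}"]) (use False in auto)
  have "Max (f ` {1..}) \<in> f ` {1..}" using fin by (intro Max_in) auto
  then obtain i where i: "1 \<le> i" "Max (f ` {1..}) = f i" by auto
  have "\<forall>\<^sub>F j in sequentially. f j = f i"
    using eventually_ge_at_top[of i]
  proof eventually_elim
    case (elim j)
    have "f j \<le> f i" using fin elim i by (metis Max_ge atLeast_iff image_eqI order_trans)
    moreover have "f i \<le> f j" using i elim by (intro mono_onD[OF mono]) auto
    ultimately show ?case by simp
  qed
  then have "f \<longlonglongrightarrow> f i" by (rule tendsto_eventually)
  then have "convergent f" "lim f = f i" by (auto simp: convergent_def limI)
  then show ?thesis using assms(2) False i by auto
qed

locale good_concatenation =
  fixes W :: "nat \<Rightarrow> bff_entry" and X :: "nat \<Rightarrow> block" and q E :: "nat \<Rightarrow> nat"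
  assumes BFF: "BFF W"
    and good: "W_good W X"
    and q_eq: "\<And>i n. 1 \<le> i \<Longrightarrow> total_length W X (i - 1) < n \<Longrightarrow> n \<le> total_length W X i \<Longrightarrow>
           q n = base (W i)"
    and conc: "is_concatenation W X E"
begin

section \<open>Section boundaries, bases and growth of the blocks\<close>

abbreviation L :: "nat \<Rightarrow> nat" where "L \<equiv> total_length W X"

lemma L_0: "L 0 = 0" by (simp add: total_length_def)

lemma L_Suc: "L (Suc i) = L i + reps (W (Suc i)) * length (X (Suc i))"
  by (simp add: total_length_def)

lemma L_mono: "i \<le> j \<Longrightarrow> L i \<le> L j"
  by (rule lift_Suc_mono_le[of L]) (simp_all add: L_Suc)

lemma base_ge_2: "1 \<le> i \<Longrightarrow> 2 \<le> base (W i)"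
  using BFF by (simp add: BFF_def)

lemma base_mono: "1 \<le> i \<Longrightarrow> i \<le> j \<Longrightarrow> base (W i) \<le> base (W j)"
  using BFF by (auto simp: BFF_def mono_on_def)

lemma eps_bounds: "1 \<le> i \<Longrightarrow> 0 < eps (W i)" "1 \<le> i \<Longrightarrow> eps (W i) < 1"
  using good by (auto simp: W_good_def normal_block_def)

text \<open>Condition (1) with its factor \<open>eps (W (i - 1)) - eps (W i)\<close> removed, which
  is possible because this factor lies between 0 and 1.\<close>

lemma eventually_dense:
  assumes "k \<in> R W"
  shows "\<forall>\<^sub>F i in sequentially. Z \<le> real (length (X i)) / real (base (W i)) ^ k"
proof -
  have "filterlim (\<lambda>i. real (length (X i)) /
            (real (base (W i)) ^ k / (eps (W (i - 1)) - eps (W i)))) at_top sequentially"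
    using good assms by (auto simp: W_good_def)
  then have "\<forall>\<^sub>F i in sequentially. max 0 Z \<le> real (length (X i)) /
            (real (base (W i)) ^ k / (eps (W (i - 1)) - eps (W i)))"
    unfolding filterlim_at_top by blast
  then show ?thesis using eventually_ge_at_top[of 2]
  proof eventually_elim
    case (elim i)
    \<comment> \<open>Index 0 carries no information, so \<open>i - 1\<close> must be at least 1 for
      the bounds on \<open>eps\<close>.\<close>
    then have "1 \<le> i - 1" "Suc (i - 1) = i" by auto
    then have "eps (W i) < eps (W (i - 1))" using BFF unfolding BFF_def by metis
    moreover have "0 < eps (W i)" "eps (W (i - 1)) < 1" using eps_bounds elim by auto
    ultimately have d: "0 < eps (W (i - 1)) - eps (W i)" "eps (W (i - 1)) - eps (W i) \<le> 1"
      using elim by auto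
    have "Z \<le> real (length (X i)) / real (base (W i)) ^ k * (eps (W (i - 1)) - eps (W i))"
      using elim by simp
    also have "\<dots> \<le> real (length (X i)) / real (base (W i)) ^ k"
      using d by (intro mult_left_le) auto
    finally show ?case .
  qed
qed

lemma zero_in_R: "0 \<in> R W" by (simp add: R_def)

lemma eventually_length_pos: "\<forall>\<^sub>F i in sequentially. 0 < length (X i)"
  using eventually_dense[OF zero_in_R, of 1] by (auto elim!: eventually_mono)

lemma eventually_reps_pos: "\<forall>\<^sub>F i in sequentially. 0 < reps (W i)"
  using good by (auto simp: W_good_def)

text \<open>Sections are eventually nonempty, so from some index on \<open>L\<close> grows by at
  least 1 per step.\<close>

lemma L_at_top: "filterlim L at_top sequentially"
proof -
  obtain i0 where i0: "\<And>i. i0 \<le> i \<Longrightarrow> 0 < reps (W i) \<and> 0 < length (X i)"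
    using eventually_conj[OF eventually_reps_pos eventually_length_pos]
    by (auto simp: eventually_sequentially)
  have step: "n \<le> L (i0 + n)" for n
  proof (induction n)
    case (Suc n)
    have "0 < reps (W (Suc (i0 + n))) * length (X (Suc (i0 + n)))"
      using i0[of "Suc (i0 + n)"] by (simp only: nat_0_less_mult_iff)
    then have "Suc n \<le> L (Suc (i0 + n))" using Suc unfolding L_Suc by linarith
    then show ?case by simp
  qed simp
  show ?thesis unfolding filterlim_at_top eventually_sequentially
  proof
    fix Z
    show "\<exists>N. \<forall>n\<ge>N. Z \<le> L n"
      using step[of Z] L_mono order_trans by blast
  qed
qed

lemma L_bracket:
  obtains i where "L i \<le> n" "n < L (Suc i)"
proof -
  have "\<forall>\<^sub>F i in sequentially. Suc n \<le> L i" using L_at_top by (simp add: filterlim_at_top)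
  then obtain j where j: "n < L j" by (auto simp: eventually_sequentially Suc_le_eq)
  \<comment> \<open>Early sections may be empty, so \<open>L\<close> can repeat values; minimality
    makes the predecessor a boundary at or below \<open>n\<close>.\<close>
  define i where "i = (LEAST j. n < L j)"
  have i: "n < L i" unfolding i_def using j by (rule LeastI)
  then obtain i' where i': "i = Suc i'" using L_0 by (cases i) auto
  have "\<not> n < L i'" using not_less_Least[of i' "\<lambda>j. n < L j"] i' i_def by simp
  then show ?thesis using that[of i'] i i' by simp
qed

lemma L_bracket':
  assumes "1 \<le> n"
  obtains i where "1 \<le> i" "L (i - 1) < n" "n \<le> L i" "q n = base (W i)"
proof -
  obtain i where "L i \<le> n - 1" "n - 1 < L (Suc i)" using L_bracket by blast
  then show ?thesis using that[of "Suc i"] q_eq[of "Suc i" n] assms by simp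
qed

lemma basic_sequence_q: "basic_sequence q"
  unfolding basic_sequence_def
proof (intro allI impI)
  fix n :: nat assume "1 \<le> n"
  then obtain i where "1 \<le> i" "q n = base (W i)" by (rule L_bracket')
  then show "2 \<le> q n" using base_ge_2 by simp
qed

lemma q_ge:
  assumes "1 \<le> i" "L (i - 1) < n"
  shows "base (W i) \<le> q n"
proof -
  obtain j where j: "L (j - 1) < n" "n \<le> L j" "q n = base (W j)"
    using L_bracket'[of n] assms by (metis One_nat_def Suc_leI gr_zeroI not_less_zero)
  have "i \<le> j"
  proof (rule ccontr)
    assume "\<not> i \<le> j"
    then have "L j \<le> L (i - 1)" by (intro L_mono) auto
    then show False using j assms by simp
  qed
  then show ?thesis using j base_mono assms by simp
qed

section \<open>Digits, occurrences and weights inside one copy\<close>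

lemma length_concat_upto: "length (concat_upto W X i) = L i"
  by (induction i) (simp_all add: concat_upto_def L_0 L_Suc length_concat_replicate)

text \<open>Copies \<open>c\<close> and offsets \<open>t\<close> are counted from 0 but
  \<open>E\<close> from 1, whence the \<open>Suc\<close>.\<close>

lemma E_eq:
  assumes c: "c < reps (W (Suc i))" and t: "t < length (X (Suc i))"
  shows "E (Suc (L i + c * length (X (Suc i)) + t)) = X (Suc i) ! t"
proof -
  let ?m = "length (X (Suc i))"
  have "Suc c * ?m \<le> reps (W (Suc i)) * ?m" using c by (intro mult_right_mono) auto
  then have less: "L i + c * ?m + t < L (Suc i)" using t by (simp add: L_Suc)
  have "E (Suc (L i + c * ?m + t)) = map E [1..<Suc (L (Suc i))] ! (L i + c * ?m + t)"
    using less by (subst nth_map) (auto simp del: upt_Suc)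
  also have "\<dots> = concat_upto W X (Suc i) ! (L i + c * ?m + t)"
    using conc by (simp add: is_concatenation_def del: upt_Suc)
  also have "concat_upto W X (Suc i)
      = concat_upto W X i @ concat (replicate (reps (W (Suc i))) (X (Suc i)))"
    by (simp add: concat_upto_def)
  also have "\<dots> ! (L i + c * ?m + t) = X (Suc i) ! t"
    using nth_concat_replicate[OF c t] by (simp add: nth_append length_concat_upto)
  finally show ?thesis .
qed

lemma eventually_ord_ge: "k \<in> R W \<Longrightarrow> \<forall>\<^sub>F i in sequentially. k \<le> ord_bound (W i)"
  using BFF by (intro mono_nat_eventually_ge) (auto simp: BFF_def R_def split: if_splits)

text \<open>As \<open>subbase (W i)\<close> tends to infinity, \<open>B\<close> is eventually a
  block in that base, so uniformity turns its weight into the power of \<open>base (W i)\<close>.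
  Membership in \<open>R W\<close> ensures that the normality of \<open>X i\<close> eventually
  covers the length of \<open>B\<close>.\<close>

lemma eventually_block_count:
  assumes k: "length B \<in> R W" "B \<noteq> []"
  shows "\<forall>\<^sub>F i in sequentially.
    real (length (X i)) / real (base (W i)) ^ length B * (1 - eps (W i))
        \<le> real (block_count (length (X i)) B (X i)) \<and>
    real (block_count (length (X i)) B (X i))
        \<le> real (length (X i)) / real (base (W i)) ^ length B * (1 + eps (W i))"
proof -
  have "\<forall>\<^sub>F i in sequentially. Suc (Max (set B)) \<le> subbase (W i)"
    using BFF by (simp add: BFF_def filterlim_at_top)
  then show ?thesis using eventually_ord_ge[OF k(1)] eventually_ge_at_top[of 1]
  proof eventually_elim
    case (elim i)
    have "block_in_base (subbase (W i)) B"
      unfolding block_in_base_def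
    proof
      fix b assume "b \<in> set B"
      then have "b \<le> Max (set B)" by simp
      then show "b \<in> {..<subbase (W i)}" using elim by simp
    qed
    then have \<mu>: "weight (W i) B = 1 / real (base (W i)) ^ length B"
      using BFF elim k by (simp add: BFF_def uniform_weighting_def)
    have "normal_block (eps (W i)) (ord_bound (W i)) (weight (W i)) (X i)"
      using good elim by (simp add: W_good_def)
    moreover have "1 \<le> length B" using k by (simp add: Suc_le_eq)
    ultimately show ?case
      using elim by (auto simp: normal_block_def \<mu>)
  qed
qed

text \<open>Here and in \<open>wt\<close>, \<open>s\<close> encodes the start position
  \<open>Suc s\<close>, matching the shifted sums for counts and for \<open>Q_sum\<close>.\<close>

abbreviation occ :: "block \<Rightarrow> nat \<Rightarrow> real" where
  "occ B s \<equiv> of_bool (\<forall>j<length B. E (Suc s + j) = B ! j)"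

abbreviation wt :: "nat \<Rightarrow> nat \<Rightarrow> real" where
  "wt k s \<equiv> 1 / (\<Prod>j<k. real (q (Suc s + j)))"

text \<open>A window may run into later sections, but bases do not decrease, so the upper bound
  survives. Equality needs the window to stay inside the section, as in
  \<open>wt_eq\<close>.\<close>

lemma wt_le:
  assumes "L i \<le> s"
  shows "wt k s \<le> 1 / real (base (W (Suc i))) ^ k"
proof -
  have pos: "0 < real (base (W (Suc i)))" using base_ge_2[of "Suc i"] by simp
  have "(\<Prod>j<k. real (base (W (Suc i)))) \<le> (\<Prod>j<k. real (q (Suc s + j)))"
    using q_ge[of "Suc i"] assms by (intro prod_mono) auto
  moreover have "0 < real (base (W (Suc i))) ^ k" using pos by simp
  ultimately show ?thesis by (intro frac_le) simp_all
qed

lemma wt_eq: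
  assumes "L i \<le> s" "s + k \<le> L (Suc i)"
  shows "wt k s = 1 / real (base (W (Suc i))) ^ k"
proof -
  have "(\<Prod>j<k. real (q (Suc s + j))) = (\<Prod>j<k. real (base (W (Suc i))))"
    using assms by (intro prod.cong) (auto simp: q_eq[of "Suc i"])
  then show ?thesis by simp
qed

lemma wt_nonneg: "0 \<le> wt k s"
  by (simp add: prod_nonneg)

lemma wt_le_1: "wt k s \<le> 1"
proof -
  have "1 / real (base (W (Suc 0))) ^ k \<le> 1" using base_ge_2[of "Suc 0"] by simp
  then show ?thesis using wt_le[of 0 s k] by (simp add: L_0)
qed

text \<open>Inside the copy the digits are the entries of \<open>X (Suc i)\<close>; windows
  straddling its end can only add occurrences, at most \<open>length B\<close> of them.\<close>

lemma occ_copy: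
  fixes B :: block
  assumes c: "c < reps (W (Suc i))"
  defines "n \<equiv> L i + c * length (X (Suc i))" and "m \<equiv> length (X (Suc i))"
  shows "real (block_count m B (X (Suc i))) \<le> (\<Sum>t<m. occ B (n + t))"
    and "(\<Sum>t<m. occ B (n + t)) \<le> real (block_count m B (X (Suc i))) + real (length B)"
proof -
  have E: "E (Suc (n + t)) = X (Suc i) ! t" if "t < m" for t
    using E_eq[OF c] that by (simp add: n_def m_def)
  have 1: "prefix B (drop t (X (Suc i))) \<longleftrightarrow> (\<forall>j<length B. E (Suc (n + t) + j) = B ! j)"
    if "t + length B \<le> m" for t
    using that E[of "t + j" for j] by (simp add: prefix_drop_iff m_def add.assoc)
  have 2: "\<not> prefix B (drop t (X (Suc i)))" if "t < m" "m < t + length B" for t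
  proof
    assume "prefix B (drop t (X (Suc i)))"
    then have "length B \<le> m - t" by (auto dest: prefix_length_le simp: m_def)
    with that show False by linarith
  qed
  show "real (block_count m B (X (Suc i))) \<le> (\<Sum>t<m. occ B (n + t))"
    "(\<Sum>t<m. occ B (n + t)) \<le> real (block_count m B (X (Suc i))) + real (length B)"
    unfolding block_count_eq_sum
    using sum_of_bool_eq_up_to_last[OF 1 2] by simp_all
qed

text \<open>The first \<open>m - k\<close> windows stay in the copy and weigh exactly
  \<open>1 / b ^ k\<close>; the others weigh between 0 and that.\<close>

lemma wt_copy:
  assumes c: "c < reps (W (Suc i))"
  defines "n \<equiv> L i + c * length (X (Suc i))" and "m \<equiv> length (X (Suc i))"
    and "b \<equiv> real (base (W (Suc i)))"
  shows "(real m - real k) / b ^ k \<le> (\<Sum>t<m. wt k (n + t))"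
    and "(\<Sum>t<m. wt k (n + t)) \<le> real m / b ^ k"
proof -
  have b: "0 < b ^ k" using base_ge_2[of "Suc i"] by (simp add: b_def)
  have "(\<Sum>t<m. wt k (n + t)) \<le> (\<Sum>t<m. 1 / b ^ k)"
    unfolding b_def by (intro sum_mono wt_le) (simp add: n_def)
  then show "(\<Sum>t<m. wt k (n + t)) \<le> real m / b ^ k" by simp
  have "Suc c * m \<le> reps (W (Suc i)) * m" using c by (intro mult_right_mono) auto
  then have le: "n + m \<le> L (Suc i)" by (simp add: L_Suc n_def m_def)
  have "(real m - real k) / b ^ k \<le> real (m - k) / b ^ k"
    using b by (intro divide_right_mono) auto
  also have "\<dots> = (\<Sum>t<m - k. 1 / b ^ k)" by simp
  also have "\<dots> = (\<Sum>t<m - k. wt k (n + t))"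
    unfolding b_def using le by (intro sum.cong wt_eq[symmetric]) (auto simp: n_def)
  also have "\<dots> \<le> (\<Sum>t<m. wt k (n + t))"
    using wt_nonneg by (intro sum_mono2) auto
  finally show "(real m - real k) / b ^ k \<le> (\<Sum>t<m. wt k (n + t))" .
qed

section \<open>Comparison of counts and weights along copies and sections\<close>

abbreviation len :: "nat \<Rightarrow> nat" where "len i \<equiv> length (X (Suc i))"

abbreviation start :: "nat \<Rightarrow> nat \<Rightarrow> nat" where "start i c \<equiv> L i + c * len i"

text \<open>With \<open>M\<close> the block length over the power of the base, count and weight of a
  copy both differ from \<open>M\<close> by a small multiple of \<open>M\<close>, uniformly in
  \<open>c\<close>. The second conclusion later bounds the weight of a whole section from
  below.\<close>

lemma eventually_copy:
  assumes B: "length B \<in> R W" "B \<noteq> []" and \<delta>: "0 < \<delta>" "\<delta> \<le> 1"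
  shows "\<forall>\<^sub>F i in sequentially. \<forall>c<reps (W (Suc i)).
     \<bar>(\<Sum>t<len i. occ B (start i c + t)) - (\<Sum>t<len i. wt (length B) (start i c + t))\<bar>
        \<le> \<delta> * (\<Sum>t<len i. wt (length B) (start i c + t)) \<and>
     real (len i) / real (base (W (Suc i))) ^ length B
        \<le> 2 * (\<Sum>t<len i. wt (length B) (start i c + t))"
proof -
  let ?k = "length B"
  \<comment> \<open>The count exceeds \<open>M\<close> by at most \<open>2 * \<eta> * M\<close> and
    the weight falls short by at most \<open>\<eta> * M\<close>. As \<open>M \<le> 2 * S\<close>,
    the difference is at most \<open>6 * \<eta> * S\<close>.\<close>
  define \<eta> where "\<eta> = \<delta> / 6"
  have \<eta>: "0 < \<eta>" "\<eta> \<le> 1 / 6" using \<delta> by (auto simp: \<eta>_def)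
  have "(\<lambda>i. eps (W i)) \<longlonglongrightarrow> 0" using BFF by (simp add: BFF_def)
  then have "\<forall>\<^sub>F i in sequentially. eps (W i) < \<eta>" using \<eta>(1) by (rule order_tendstoD)
  then have "\<forall>\<^sub>F i in sequentially. eps (W i) < \<eta> \<and>
     real ?k / \<eta> \<le> real (length (X i)) / real (base (W i)) ^ ?k \<and>
     real (length (X i)) / real (base (W i)) ^ ?k * (1 - eps (W i))
        \<le> real (block_count (length (X i)) B (X i)) \<and>
    real (block_count (length (X i)) B (X i))
        \<le> real (length (X i)) / real (base (W i)) ^ ?k * (1 + eps (W i))"
    using eventually_dense[OF B(1), of "real ?k / \<eta>"] eventually_block_count[OF B]
    by eventually_elim blast
  then have "\<forall>\<^sub>F i in sequentially. eps (W (Suc i)) < \<eta> \<and>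
     real ?k / \<eta> \<le> real (length (X (Suc i))) / real (base (W (Suc i))) ^ ?k \<and>
     real (length (X (Suc i))) / real (base (W (Suc i))) ^ ?k * (1 - eps (W (Suc i)))
        \<le> real (block_count (length (X (Suc i))) B (X (Suc i))) \<and>
    real (block_count (length (X (Suc i))) B (X (Suc i)))
        \<le> real (length (X (Suc i))) / real (base (W (Suc i))) ^ ?k * (1 + eps (W (Suc i)))"
    by (subst eventually_sequentially_Suc)
  then show ?thesis
  proof eventually_elim
    case (elim i)
    show ?case
    proof (intro allI impI)
      fix c assume c: "c < reps (W (Suc i))"
      define n m where "n = L i + c * length (X (Suc i))" and "m = length (X (Suc i))"
      define b where "b = real (base (W (Suc i)))"
      define M where "M = real m / b ^ ?k"
      define A where "A = (\<Sum>t<m. occ B (n + t))"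
      define S where "S = (\<Sum>t<m. wt ?k (n + t))"
      have M: "0 \<le> M" by (simp add: M_def b_def)
      have "1 \<le> b ^ ?k" using base_ge_2[of "Suc i"] by (simp add: b_def)
      then have "real ?k / b ^ ?k \<le> real ?k"
        using mult_left_mono[of 1 "b ^ ?k" "real ?k"] by (simp add: divide_le_eq)
      \<comment> \<open>Density of the block absorbs the boundary error \<open>?k\<close> into
        \<open>\<eta> * M\<close>.\<close>
      moreover have kM: "real ?k \<le> \<eta> * M"
        using elim \<eta> by (simp add: M_def m_def b_def pos_divide_le_eq mult.commute)
      moreover have "M - real ?k / b ^ ?k \<le> S" "S \<le> M"
        using wt_copy[OF c, of ?k] by (simp_all add: M_def S_def m_def b_def n_def diff_divide_distrib)
      ultimately have S: "M - \<eta> * M \<le> S" "S \<le> M" by linarith+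
      have "M * (1 - eps (W (Suc i))) \<le> A" "A \<le> M * (1 + eps (W (Suc i))) + real ?k"
        using elim occ_copy[OF c, of B] by (auto simp: M_def A_def m_def b_def n_def)
      moreover have "M * eps (W (Suc i)) \<le> \<eta> * M"
        using elim M by (metis less_imp_le mult.commute mult_right_mono)
      ultimately have A: "M - \<eta> * M \<le> A" "A \<le> M + 2 * (\<eta> * M)"
        using kM by (simp_all add: algebra_simps)
      have "\<eta> * M \<le> 1 / 6 * M" using \<eta> M by (intro mult_right_mono)
      then have MS: "M \<le> 2 * S" using S by linarith
      have "\<bar>A - S\<bar> \<le> 3 * \<eta> * M" using A S by (simp add: abs_le_iff)
      also have "\<dots> \<le> 3 * \<eta> * (2 * S)" using MS \<eta> by (intro mult_left_mono) auto
      finally have "\<bar>A - S\<bar> \<le> \<delta> * S" by (simp add: \<eta>_def)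
      with MS show "\<bar>(\<Sum>t<len i. occ B (start i c + t)) - (\<Sum>t<len i. wt ?k (start i c + t))\<bar>
            \<le> \<delta> * (\<Sum>t<len i. wt ?k (start i c + t)) \<and>
         real (len i) / real (base (W (Suc i))) ^ ?k
            \<le> 2 * (\<Sum>t<len i. wt ?k (start i c + t))"
        by (simp add: A_def S_def M_def n_def m_def b_def)
    qed
  qed
qed

lemma section_sum:
  "(\<Sum>s<L (Suc i). wt k s) = (\<Sum>s<L i. wt k s) +
     (\<Sum>c<reps (W (Suc i)). \<Sum>t<length (X (Suc i)). wt k (L i + c * length (X (Suc i)) + t))"
proof -
  have "(\<Sum>s<L i + l * m. f s)
      = (\<Sum>s<L i. f s) + (\<Sum>c<l. \<Sum>t<m. f (L i + c * m + t))" for f :: "nat \<Rightarrow> real" and l m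
  proof (induction l)
    case (Suc l)
    have "L i + Suc l * m = (L i + l * m) + m" by simp
    then show ?case by (simp only: sum_lessThan_add[of f "L i + l * m"] Suc) (simp add: add.assoc)
  qed simp
  then show ?thesis by (simp add: L_Suc)
qed

text \<open>Sums the lower bound for one copy over all copies of the section. It serves both to
  absorb an incomplete copy and to show that the weights diverge.\<close>

lemma eventually_section_weight_ge:
  fixes B :: block
  assumes B: "length B \<in> R W" "B \<noteq> []"
  shows "\<forall>\<^sub>F i in sequentially.
    real (reps (W (Suc i))) * (real (len i) / real (base (W (Suc i))) ^ length B)
      \<le> 2 * (\<Sum>s<L (Suc i). wt (length B) s)"
proof -
  let ?k = "length B"
  let ?M = "\<lambda>i. real (len i) / real (base (W (Suc i))) ^ ?k"
  have "\<forall>\<^sub>F i in sequentially. \<forall>c<reps (W (Suc i)).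
     ?M i \<le> 2 * (\<Sum>t<len i. wt ?k (start i c + t))"
    using eventually_copy[OF B, of 1] by (rule eventually_mono) simp_all
  then show ?thesis
  proof eventually_elim
    case (elim i)
    have "real (reps (W (Suc i))) * ?M i = (\<Sum>c<reps (W (Suc i)). ?M i)" by simp
    also have "\<dots> \<le> (\<Sum>c<reps (W (Suc i)). 2 * (\<Sum>t<len i. wt ?k (start i c + t)))"
      using elim by (intro sum_mono) blast
    also have "\<dots> \<le> 2 * (\<Sum>s<L (Suc i). wt ?k s)"
      unfolding section_sum sum_distrib_left[symmetric]
      using sum_nonneg[of "{..<L i}" "wt ?k"] wt_nonneg by simp
    finally show ?case .
  qed
qed

text \<open>Complete copies beyond \<open>L i0\<close> contribute one \<delta>, everything before
  goes into \<open>C\<close>, and the incomplete last copy contributes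
  \<open>2 * \<delta>\<close>.\<close>

lemma count_close:
  assumes B: "length B \<in> R W" "B \<noteq> []" and \<delta>: "0 < \<delta>" "\<delta> \<le> 1"
  shows "\<exists>C. \<forall>\<^sub>F n in sequentially.
    \<bar>(\<Sum>s<n. occ B s) - (\<Sum>s<n. wt (length B) s)\<bar> \<le> C + 3 * \<delta> * (\<Sum>s<n. wt (length B) s)"
proof -
  let ?k = "length B"
  let ?M = "\<lambda>i. real (length (X (Suc i))) / real (base (W (Suc i))) ^ ?k"
  let ?S = "\<lambda>n. \<Sum>s<n. wt ?k s"
  let ?D = "\<lambda>n. \<bar>(\<Sum>s<n. occ B s) - ?S n\<bar>"
  have "\<exists>i0. \<forall>i\<ge>i0. \<forall>c<reps (W (Suc i)).
     \<bar>(\<Sum>t<len i. occ B (start i c + t)) - (\<Sum>t<len i. wt ?k (start i c + t))\<bar>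
        \<le> \<delta> * (\<Sum>t<len i. wt ?k (start i c + t)) \<and>
     ?M i \<le> 2 * (\<Sum>t<len i. wt ?k (start i c + t))"
    using eventually_copy[OF B \<delta>] by (simp only: eventually_sequentially)
  then obtain i0 where copy: "\<forall>i\<ge>i0. \<forall>c<reps (W (Suc i)).
     \<bar>(\<Sum>t<len i. occ B (start i c + t)) - (\<Sum>t<len i. wt ?k (start i c + t))\<bar>
        \<le> \<delta> * (\<Sum>t<len i. wt ?k (start i c + t)) \<and>
     ?M i \<le> 2 * (\<Sum>t<len i. wt ?k (start i c + t))" ..
  define C where "C = ?D (L i0)"
  have copies: "?D (L i + c * length (X (Suc i))) \<le> C + \<delta> * ?S (L i + c * length (X (Suc i)))"
    if "i0 \<le> i" "c \<le> reps (W (Suc i))" "?D (L i) \<le> C + \<delta> * ?S (L i)" for i c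
    using that(2)
  proof (induction c)
    case (Suc c)
    define n m where "n = L i + c * length (X (Suc i))" and "m = length (X (Suc i))"
    have "?D n \<le> C + \<delta> * ?S n" using Suc by (simp add: n_def)
    moreover have "\<bar>(\<Sum>t<m. occ B (n + t)) - (\<Sum>t<m. wt ?k (n + t))\<bar>
        \<le> \<delta> * (\<Sum>t<m. wt ?k (n + t))"
      unfolding n_def m_def using copy that(1) Suc.prems Suc_le_lessD by blast
    ultimately have "?D (n + m) \<le> C + \<delta> * ?S (n + m)"
      unfolding sum_lessThan_add distrib_left by linarith
    then show ?case by (simp add: n_def m_def ac_simps)
  qed (use that in simp)
  have sections: "?D (L i) \<le> C + \<delta> * ?S (L i)" if "i0 \<le> i" for i
    using that
  proof (induction i rule: dec_induct)
    case base
    have "0 \<le> \<delta> * ?S (L i0)" using \<delta> wt_nonneg by (intro mult_nonneg_nonneg sum_nonneg) auto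
    then show ?case unfolding C_def by linarith
  next
    case (step i)
    then show ?case using copies[of i "reps (W (Suc i))"] by (simp add: L_Suc)
  qed
  have "(\<lambda>i. 1 / real (reps (W i)) * (real (length (X (i + 1))) / real (length (X i))))
          \<in> o(\<lambda>i. 1 / real (base (W i)) ^ ?k)"
    using good B by (simp add: W_good_def)
  then have "\<forall>\<^sub>F i in sequentially.
      1 / real (reps (W i)) * (real (length (X (i + 1))) / real (length (X i)))
        \<le> \<delta> * (1 / real (base (W i)) ^ ?k)"
    using landau_o.smallD[OF _ \<delta>(1)] by fastforce
  \<comment> \<open>Condition (3) with the denominators cleared: one block of the next section is
    short compared with the scale of the present section.\<close>
  then have "\<forall>\<^sub>F i in sequentially. real (length (X (Suc i)))
      \<le> \<delta> * (real (reps (W i)) * (real (length (X i)) / real (base (W i)) ^ ?k))"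
    using eventually_reps_pos eventually_length_pos
  proof eventually_elim
    case (elim i)
    then show ?case by (simp add: field_simps)
  qed
  then obtain i1 where i1: "\<And>i. i1 \<le> i \<Longrightarrow> real (length (X (Suc i)))
      \<le> \<delta> * (real (reps (W i)) * (real (length (X i)) / real (base (W i)) ^ ?k))"
    by (auto simp: eventually_sequentially)
  obtain i2 where section_ge: "\<And>i. i2 \<le> i \<Longrightarrow>
      real (reps (W (Suc i))) * ?M i \<le> 2 * ?S (L (Suc i))"
    using eventually_section_weight_ge[OF B] unfolding eventually_sequentially by blast
  \<comment> \<open>The extra \<open>Suc\<close> gives \<open>i\<close> a predecessor
    \<open>i'\<close> that is still at least \<open>i2\<close>; \<open>section_ge\<close> is indexed
    by that predecessor.\<close>
  define N where "N = L (Suc (i0 + i1 + i2))"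
  have "?D n \<le> C + 3 * \<delta> * ?S n" if "N \<le> n" for n
  proof -
    obtain i where i: "L i \<le> n" "n < L (Suc i)" using L_bracket by blast
    have "Suc (i0 + i1 + i2) \<le> i"
    proof (rule ccontr)
      assume "\<not> Suc (i0 + i1 + i2) \<le> i"
      then have "L (Suc i) \<le> N" unfolding N_def by (intro L_mono) auto
      then show False using i that by simp
    qed
    then obtain i' where i': "i = Suc i'" "i2 \<le> i'" "i1 \<le> i" "i0 \<le> i" by (cases i) auto
    define m where "m = length (X (Suc i))"
    \<comment> \<open>\<open>c\<close> complete copies of the current block fit before
      \<open>n\<close>, and \<open>r\<close> positions of the next copy remain.\<close>
    define c r where "c = (n - L i) div m" and "r = (n - L i) mod m"
    have "n - L i < reps (W (Suc i)) * m" using i by (simp add: L_Suc m_def)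
    then have c: "c < reps (W (Suc i))" and r: "r < m"
      by (auto simp: c_def r_def less_mult_imp_div_less intro!: mod_less_divisor)
        (metis gr0I mult_0_right not_less_zero)
    have n: "n = (L i + c * m) + r" using i by (simp add: c_def r_def)
    have term_le: "\<bar>occ B s - wt ?k s\<bar> \<le> 1" for s
    proof -
      have "0 \<le> occ B s" "occ B s \<le> 1" by simp_all
      then show ?thesis
        using wt_nonneg[where k = ?k and s = s] wt_le_1[where k = ?k and s = s]
        unfolding abs_le_iff by linarith
    qed
    have "\<bar>\<Sum>t<r. occ B (L i + c * m + t) - wt ?k (L i + c * m + t)\<bar>
        \<le> (\<Sum>t<r. \<bar>occ B (L i + c * m + t) - wt ?k (L i + c * m + t)\<bar>)"
      by (rule sum_abs)
    also have "\<dots> \<le> (\<Sum>t<r. 1)"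
      by (rule sum_mono) (rule term_le)
    finally have part: "\<bar>(\<Sum>t<r. occ B (L i + c * m + t))
        - (\<Sum>t<r. wt ?k (L i + c * m + t))\<bar> \<le> real r"
      by (simp only: sum_subtractf) simp
    have S_mono: "?S n' \<le> ?S n" if "n' \<le> n" for n'
      by (rule sum_mono2) (use that wt_nonneg in auto)
    have "L i + c * m \<le> n" using n by linarith
    note mono = S_mono[OF i(1)] S_mono[OF this]
    \<comment> \<open>The remainder is shorter than one block of section \<open>Suc i\<close>, hence
      bounded through section \<open>i\<close>, whose weight is already part of
      \<open>?S (L i)\<close>.\<close>
    have "real r \<le> \<delta> * (real (reps (W i)) * ?M i')"
      using i1[of i] r i' by (simp add: m_def)
    also have "\<dots> \<le> \<delta> * (2 * ?S (L i))"
      using section_ge[of i'] i' \<delta> by (intro mult_left_mono) auto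
    also have "\<dots> \<le> \<delta> * (2 * ?S n)" using mono \<delta> by (intro mult_left_mono) auto
    finally have rS: "real r \<le> 2 * (\<delta> * ?S n)" by simp
    have "?D (L i + c * m) \<le> C + \<delta> * ?S (L i + c * m)"
      using copies[of i c] sections[of i] i' c by (simp add: m_def)
    also have "\<dots> \<le> C + \<delta> * ?S n" using mono \<delta> by simp
    finally have "?D (L i + c * m) \<le> C + \<delta> * ?S n" .
    moreover have "?D n \<le> ?D (L i + c * m) + real r"
      using part unfolding n sum_lessThan_add by linarith
    ultimately show ?thesis using rS by simp
  qed
  then show "\<exists>C. \<forall>\<^sub>F n in sequentially. ?D n \<le> C + 3 * \<delta> * ?S n"
    unfolding eventually_sequentially by blast
qed

text \<open>A single late section already weighs at least half its number of copies times block
  length over the power of the base, which exceeds any bound.\<close>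

lemma wt_sum_at_top:
  fixes B :: block
  assumes B: "length B \<in> R W" "B \<noteq> []"
  shows "filterlim (\<lambda>n. \<Sum>s<n. wt (length B) s) at_top sequentially"
  unfolding filterlim_at_top
proof
  fix Z :: real
  let ?k = "length B"
  obtain i0 where i0: "\<And>i. i0 \<le> i \<Longrightarrow> real (reps (W (Suc i))) *
      (real (length (X (Suc i))) / real (base (W (Suc i))) ^ ?k) \<le> 2 * (\<Sum>s<L (Suc i). wt ?k s)"
    using eventually_section_weight_ge[OF B] unfolding eventually_sequentially by blast
  have "\<forall>\<^sub>F i in sequentially. 2 * max 0 Z \<le> real (length (X i)) / real (base (W i)) ^ ?k \<and> 0 < reps (W i)"
    using eventually_dense[OF B(1), of "2 * max 0 Z"] eventually_reps_pos by (rule eventually_conj)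
  then obtain i1 where i1: "\<And>i. i1 \<le> i \<Longrightarrow>
      2 * max 0 Z \<le> real (length (X i)) / real (base (W i)) ^ ?k \<and> 0 < reps (W i)"
    unfolding eventually_sequentially by blast
  let ?i = "Suc (i0 + i1)"
  have "1 * (2 * max 0 Z) \<le> real (reps (W ?i)) * (real (length (X ?i)) / real (base (W ?i)) ^ ?k)"
    using i1[of ?i] by (intro mult_mono) auto
  also have "\<dots> \<le> 2 * (\<Sum>s<L ?i. wt ?k s)" using i0[of "i0 + i1"] by simp
  finally have "Z \<le> (\<Sum>s<L ?i. wt ?k s)" by simp
  also have "\<dots> \<le> (\<Sum>s<n. wt ?k s)" if "L ?i \<le> n" for n
    using that wt_nonneg by (intro sum_mono2) auto
  finally show "\<forall>\<^sub>F n in sequentially. Z \<le> (\<Sum>s<n. wt ?k s)"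
    unfolding eventually_sequentially by blast
qed

lemma seq_count_tendsto:
  assumes B: "length B \<in> R W" "B \<noteq> []"
  shows "(\<lambda>n. real (seq_count n B E) / Q_sum q (length B) n) \<longlonglongrightarrow> 1"
  unfolding seq_count_eq_sum Q_sum_eq_sum
proof (rule tendsto_1_if_diff_small[OF wt_sum_at_top[OF B]])
  fix \<delta> :: real assume \<delta>: "0 < \<delta>" "\<delta> < 1"
  then show "\<exists>C. \<forall>\<^sub>F n in sequentially.
      \<bar>(\<Sum>s<n. occ B s) - (\<Sum>s<n. wt (length B) s)\<bar> \<le> C + \<delta> * (\<Sum>s<n. wt (length B) s)"
    using count_close[OF B, of "\<delta> / 3"] by simp
qed

text \<open>
  For \<open>k = 0\<close> alone the digits may well be eventually \<open>q n - 1\<close>; a positive order forces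
  infinitely many zeros.
\<close>

lemma infinitely_many_not_max:
  assumes "k \<in> R W" "0 < k"
  shows "\<exists>\<^sub>\<infinity>n. E n \<noteq> q n - 1"
proof (rule ccontr)
  assume "\<not> ?thesis"
  then obtain N where N: "\<And>n. N \<le> n \<Longrightarrow> E n = q n - 1"
    by (auto simp: INFM_nat_le)
  \<comment> \<open>\<open>R W\<close> is an initial segment of the naturals, so with a positive
    \<open>k\<close> it contains 1.\<close>
  have B: "length [0::nat] \<in> R W" using assms by (auto simp: R_def split: if_splits)
  have occ0: "occ [0] s = 0" if "N \<le> s" for s
  proof -
    have "2 \<le> q (Suc s)" using basic_sequence_q by (simp add: basic_sequence_def)
    then show ?thesis using N[of "Suc s"] that by simp
  qed
  have "(\<Sum>s<n. occ [0] s) \<le> real N" for n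
  proof -
    have "(\<Sum>s<n. occ [0] s) \<le> (\<Sum>s<n. of_bool (s < N))"
    proof (rule sum_mono)
      fix s show "occ [0] s \<le> of_bool (s < N)" using occ0[of s] by (cases "s < N") auto
    qed
    also have "\<dots> = real (card ({..<n} \<inter> {..<N}))" by (simp add: of_bool_def sum.If_cases lessThan_def)
    also have "\<dots> \<le> real (card {..<N})" by (intro of_nat_mono card_mono) auto
    finally show ?thesis by simp
  qed
  then have bound: "real (seq_count n [0] E) \<le> real N" for n
    using seq_count_eq_sum[of n "[0]" E] by simp
  have "Q_sum q 1 = (\<lambda>n. \<Sum>s<n. wt (length [0::nat]) s)"
    by (rule ext) (simp add: Q_sum_eq_sum)
  then have Q: "filterlim (Q_sum q 1) at_top sequentially"
    using wt_sum_at_top[OF B] by simp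
  \<comment> \<open>This limit concerns \<open>E\<close> itself, not the digits of a real, so there
    is no circularity. It would make the bounded count of zeros exceed half of a divergent
    sum.\<close>
  have "\<forall>\<^sub>F n in sequentially. 1 / 2 < real (seq_count n [0] E) / Q_sum q 1 n"
    using order_tendstoD(1)[OF seq_count_tendsto[OF B], of "1 / 2"] by simp
  moreover have "\<forall>\<^sub>F n in sequentially. 2 * real N + 1 \<le> Q_sum q 1 n"
    using Q by (simp add: filterlim_at_top)
  ultimately have "\<forall>\<^sub>F n in sequentially. False"
  proof eventually_elim
    case (elim n)
    then show ?case using bound[of n] by (simp add: field_simps)
  qed
  then show False by simp
qed

end

section \<open>Normality of the constructed number\<close>

theorem theorem1p15:
  fixes W :: "nat \<Rightarrow> bff_entry" and X :: "nat \<Rightarrow> block"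
    and q E :: "nat \<Rightarrow> nat" and x :: real
  assumes "BFF W"
    and "W_good W X"
    and "\<And>i n. 1 \<le> i \<Longrightarrow> total_length W X (i - 1) < n \<Longrightarrow> n \<le> total_length W X i \<Longrightarrow>
           q n = base (W i)"
    and "is_concatenation W X E"
    and "\<And>n. 1 \<le> n \<Longrightarrow> E n < q n"
    and "x = (\<Sum>n. cantor_term q E (Suc n))"
  shows "(\<forall>k\<in>R W. Q_normal_of_order q k x) \<and>
         (filterlim (\<lambda>i. ord_bound (W i)) at_top sequentially \<longrightarrow> Q_normal q x)"
proof -
  interpret good_concatenation W X q E by (rule good_concatenation.intro) (fact assms)+
  have normal: "Q_normal_of_order q k x" if k: "k \<in> R W" for k
    unfolding Q_normal_of_order_def
  proof (intro conjI allI impI basic_sequence_q)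
    fix B :: block assume len: "length B = k"
    show "(\<lambda>n. real (cantor_count q n B x) / Q_sum q k n) \<longlonglongrightarrow> 1"
    proof (cases "k = 0")
      case True
      \<comment> \<open>The empty block starts at all \<open>n\<close> positions, whatever the
        digits are, and \<open>Q_sum q 0 n\<close> equals \<open>n\<close>.\<close>
      have "\<forall>\<^sub>F n in sequentially. real (cantor_count q n B x) / Q_sum q k n = 1"
        using eventually_gt_at_top[of 0]
        by eventually_elim
          (use True len in \<open>simp add: cantor_count_def seq_count_eq_sum Q_sum_def\<close>)
      then show ?thesis by (rule tendsto_eventually)
    next
      case False
      have "cantor_digits q x = E(0 := 0)"
        unfolding assms(6)
        using infinitely_many_not_max[OF k] False
        by (intro cantor_digits_eq basic_sequence_q assms(5)) simp_all
      moreover have "seq_count n B (E(0 := 0)) = seq_count n B E" for n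
        unfolding seq_count_def by (intro arg_cong[where f = card] Collect_cong conj_cong refl) simp
      ultimately have "cantor_count q n B x = seq_count n B E" for n
        by (simp add: cantor_count_def)
      moreover have "B \<noteq> []" using False len by auto
      ultimately show ?thesis using seq_count_tendsto[of B] k len by simp
    qed
  qed
  moreover have "R W = UNIV" if lim: "filterlim (\<lambda>i. ord_bound (W i)) at_top sequentially"
  proof -
    have "\<not> convergent (\<lambda>i. ord_bound (W i))"
    proof
      assume "convergent (\<lambda>i. ord_bound (W i))"
      \<comment> \<open>Convergence in the discrete space \<open>nat\<close> means being eventually
        constant.\<close>
      then obtain K where "\<forall>\<^sub>F i in sequentially. ord_bound (W i) = K"
        by (auto simp: convergent_def tendsto_discrete)
      moreover have "\<forall>\<^sub>F i in sequentially. Suc K \<le> ord_bound (W i)"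
        using lim by (simp add: filterlim_at_top)
      ultimately have "\<forall>\<^sub>F i in sequentially. False" by eventually_elim simp
      then show False by simp
    qed
    then show ?thesis by (simp add: R_def)
  qed
  ultimately show ?thesis by (auto simp: Q_normal_def)
qed

end
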